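(* Let $F$ be a field of characteristic $p>0$, $n=2m$ with $m\ge 1$, and let $\mathfrak{a}(n)_p$ be any one of the Lie algebras $\mathfrak{h}(n)_p$, $\mathfrak{h}^{(2)}(n)_p$ or the corresponding Poisson algebras $\mathfrak{po}(n)_p$, $\mathfrak{po}^{(2)}(n)_p$ over $F$, equipped with the symmetric grading. Then all non-trivial cohomologies $H^k_{g}\left(\mathfrak{a}(n)_p\right)$ lie in the grades $g=\pm pj$ for $j$ integer; that is, for all integers $k\ge 0$ and $g$, if $H^k_{g}\left(\mathfrak{a}(n)_p\right)\neq 0$ then $g$ is an integer multiple of $p$.
   Context: Divided powers. Let $x_1,\dots,x_n$ be indeterminates, $n=2m$. The divided power algebra over $F$ has basis $\mathbf{x}^{(\mathbf{r})}=x_1^{(r_1)}\cdots x_n^{(r_n)}$, $\mathbf{r}\in\mathbb{Z}_{\ge 0}^n$ (where $x_i^{(r)}$ plays the role of $x_i^r/r!$), with product $\mathbf{x}^{(\mathbf{r})}\mathbf{x}^{(\mathbf{s})}=\binom{\mathbf{r}+\mathbf{s}}{\mathbf{r}}\mathbf{x}^{(\mathbf{r}+\mathbf{s})}$, $\binom{\mathbf{r}+\mathbf{s}}{\mathbf{r}}=\prod_i\binom{r_i+s_i}{r_i}$, and derivations $\partial_i x_i^{(r)}=x_i^{(r-1)}$ (with $x_i^{(-1)}=0$), $\partial_i x_j^{(r)}=0$ for $j\ne i$. The Poisson bracket is $\{f,h\}=\sum_{i=1}^m(\partial_i f\,\partial_{i+m}h-\partial_{i+m}f\,\partial_i h)$,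 corresponding to the symplectic form $\omega=\sum_{i=1}^m dx_i\wedge dx_{i+m}$. Algebras. The truncated Poisson algebra is $$\mathfrak{po}(n)_p=\mathrm{span}\{\mathbf{x}^{(\mathbf{r})}\mid 0\le r_i<p\}\oplus\mathrm{span}\{x_1^{(p)},\dots,x_n^{(p)}\}$$ with the Poisson bracket (dimension $p^n+n$). The truncated Hamiltonian algebra $\mathfrak{h}(n)_p$ is its quotient by the central subspace of constants $F\cdot 1$, i.e. it has basis $\{\mathbf{x}^{(\mathbf{r})}\mid 0\le r_i<p,\ 0<\sum_i r_i\}\cup\{x_1^{(p)},\dots,x_n^{(p)}\}$ with the Poisson bracket taken modulo constants (dimension $p^n+n-1$). The algebra $\mathfrak{h}^{(2)}(n)_p$ is the subalgebra of $\mathfrak{h}(n)_p$ spanned by $\{\mathbf{x}^{(\mathbf{r})}\mid 0\le r_i<p,\ 0<\sum_i r_i<n(p-1)\}$ (dimension $p^n-2$). The algebra $\mathfrak{po}^{(2)}(n)_p$ is the Poisson algebra corresponding to $\mathfrak{h}^{(2)}(n)_p$, i.e. the preimage of $\mathfrak{h}^{(2)}(n)_p$ in $\mathfrak{po}(n)_p$, spanned by $\{\mathbf{x}^{(\mathbf{r})}\mid 0\le r_i<p,\ 0\le\sum_i r_i<n(p-1)\}$. Symmetric grading. This is the $\mathbb{Z}$-grading induced by $\deg x_i=-1$ and $\deg x_{i+m}=1$ for $1\le i\le m$; thus $\mathbf{x}^{(\mathbf{r})}$ has grade $\sum_{i=1}^m(r_{i+m}-r_i)$. The bracket preserves this grading,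 so $\mathfrak{a}(n)_p=\bigoplus_i L_i$ is a $\mathbb{Z}$-graded Lie algebra. Graded cohomology. $C^k(\mathfrak{a})$ denotes the space of alternating $k$-linear forms on $\mathfrak{a}$ with values in the trivial module $F$ (the dual of $\Lambda^k\mathfrak{a}$), with the Chevalley–Eilenberg differential. $C^k_g(\mathfrak{a})$ is the subspace of cochains vanishing on $L_{g_1}\times\cdots\times L_{g_k}$ whenever $g_1+\cdots+g_k\neq g$. For each $g$, $C^*_g(\mathfrak{a})$ is a subcomplex, and $H^k_g(\mathfrak{a})$ is its $k$-th cohomology.
   Formalization: For n=2, p=2 the algebras h^(2)(2)_2 and po^(2)(2)_2 are excluded: there x_1x_2 is not in the algebra and the dual of x_2 is a nonzero class in H^1_1, so the claim fails for exactly these two; all other cases are covered. *)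

theory Defs
  imports Complex_Main "HOL-Library.Poly_Mapping" "HOL-Library.Function_Algebras"
begin

section \<open>The divided power algebra and its Poisson bracket\<close>

text \<open>
  A multi-index is a finitely supported function on the naturals, and an element of the divided
  power algebra is the finitely supported family of its coefficients. The built-in product of
  polynomial mappings is the ordinary convolution product, which is \<^emph>\<open>not\<close> the divided power
  product, so the latter is defined separately as \<open>dp_mult\<close>.
  The indeterminates are numbered from \<open>1\<close>. Only \<open>1, \<dots>, 2 * m\<close> occur in the algebras below.
\<close>

type_synonym mindex = "nat \<Rightarrow>\<^sub>0 nat"
type_synonym 'a dp = "mindex \<Rightarrow>\<^sub>0 'a"

definition dp_scale :: "'a::field \<Rightarrow> 'a dp \<Rightarrow> 'a dp" where
  "dp_scale c f = Poly_Mapping.map ((*) c) f"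

lemma lookup_dp_scale [simp]: "Poly_Mapping.lookup (dp_scale c f) r = c * Poly_Mapping.lookup f r"
  by (cases "Poly_Mapping.lookup f r = 0") (simp_all add: dp_scale_def Poly_Mapping.map.rep_eq)

global_interpretation dp: vector_space dp_scale
  by unfold_locales
    (auto intro!: poly_mapping_eqI simp: lookup_add algebra_simps)

definition dp_monom :: "mindex \<Rightarrow> 'a::field dp" where
  "dp_monom r = Poly_Mapping.single r 1"

lemma keys_scale_monom: "Poly_Mapping.keys (dp_scale a (dp_monom r)) \<subseteq> {r}"
  by (auto simp: in_keys_iff dp_monom_def lookup_single Poly_Mapping.when_def split: if_splits)

lemma span_dp_monom: "dp.span (dp_monom ` S) = {f. Poly_Mapping.keys f \<subseteq> S}"
proof (intro equalityI subsetI)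
  fix f :: "'a dp" assume "f \<in> dp.span (dp_monom ` S)"
  then show "f \<in> {f. Poly_Mapping.keys f \<subseteq> S}"
  proof (induction rule: dp.span_induct_alt)
    case base then show ?case by simp
  next
    case (step c x y)
    then obtain r where "x = dp_monom r" "r \<in> S" by auto
    with step keys_scale_monom[of c r] Poly_Mapping.keys_add[of "dp_scale c x" y] show ?case by auto
  qed
next
  fix f :: "'a dp" assume "f \<in> {f. Poly_Mapping.keys f \<subseteq> S}"
  then have k: "Poly_Mapping.keys f \<subseteq> S" by simp
  have "f = (\<Sum>r\<in>Poly_Mapping.keys f. dp_scale (Poly_Mapping.lookup f r) (dp_monom r))"
    by (rule poly_mapping_eqI)
      (simp add: lookup_sum dp_monom_def lookup_single Poly_Mapping.when_def sum.delta' in_keys_iff if_distrib cong: if_cong)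
  also have "\<dots> \<in> dp.span (dp_monom ` S)"
    using k by (intro dp.span_sum dp.span_scale dp.span_base) auto
  finally show "f \<in> dp.span (dp_monom ` S)" .
qed

definition mbinomial :: "mindex \<Rightarrow> mindex \<Rightarrow> nat" where
  "mbinomial t r = (\<Prod>i\<in>Poly_Mapping.keys t. Poly_Mapping.lookup t i choose Poly_Mapping.lookup r i)"

definition dp_mult :: "'a::field dp \<Rightarrow> 'a dp \<Rightarrow> 'a dp" where
  "dp_mult f h = (\<Sum>r\<in>Poly_Mapping.keys f. \<Sum>s\<in>Poly_Mapping.keys h.
     dp_scale (Poly_Mapping.lookup f r * Poly_Mapping.lookup h s * of_nat (mbinomial (r + s) r)) (dp_monom (r + s)))"

definition dp_deriv :: "nat \<Rightarrow> 'a::field dp \<Rightarrow> 'a dp" where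
  "dp_deriv i f = (\<Sum>r\<in>{r \<in> Poly_Mapping.keys f. 0 < Poly_Mapping.lookup r i}.
     dp_scale (Poly_Mapping.lookup f r) (dp_monom (r - Poly_Mapping.single i 1)))"

definition poisson :: "nat \<Rightarrow> 'a::field dp \<Rightarrow> 'a dp \<Rightarrow> 'a dp" where
  "poisson m f h = (\<Sum>i=1..m.
     dp_mult (dp_deriv i f) (dp_deriv (i + m) h) - dp_mult (dp_deriv (i + m) f) (dp_deriv i h))"

definition drop_const :: "'a::field dp \<Rightarrow> 'a dp" where
  "drop_const f = f - dp_scale (Poly_Mapping.lookup f 0) (dp_monom 0)"

lemma dp_deriv_drop_const: "dp_deriv i (drop_const f) = dp_deriv i f"
proof -
  have l: "Poly_Mapping.lookup (drop_const f) r = (if r = 0 then 0 else Poly_Mapping.lookup f r)" for r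
    by (auto simp: drop_const_def dp_monom_def lookup_minus lookup_single_not_eq simp del: single_one)
  have "{r \<in> Poly_Mapping.keys (drop_const f). 0 < Poly_Mapping.lookup r i} = {r \<in> Poly_Mapping.keys f. 0 < Poly_Mapping.lookup r i}"
    by (auto simp: in_keys_iff l)
  then show ?thesis
    unfolding dp_deriv_def by (rule sum.cong) (auto simp: l)
qed

text \<open>Hence the bracket is well defined modulo constants.\<close>

lemma poisson_drop_const: "poisson m (drop_const f) (drop_const h) = poisson m f h"
  by (simp add: poisson_def dp_deriv_drop_const)


section \<open>Graded Lie algebras and graded cohomology with trivial coefficients\<close>

record ('a, 'v) graded_lie =
  gl_scale :: "'a \<Rightarrow> 'v \<Rightarrow> 'v"
  gl_carrier :: "'v set"
  gl_bracket :: "'v \<Rightarrow> 'v \<Rightarrow> 'v"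
  gl_comp :: "int \<Rightarrow> 'v set"

text \<open>
  A \<open>k\<close>-cochain is a function on argument lists. It is extended by \<open>0\<close> to lists that are not
  lists of \<open>k\<close> elements of the carrier, so that equality of cochains is equality of functions.
\<close>

definition cochains :: "('a::field, 'v::ab_group_add) graded_lie \<Rightarrow> nat \<Rightarrow> ('v list \<Rightarrow> 'a) set" where
  "cochains A k = {c.
     (\<forall>vs. \<not> (length vs = k \<and> set vs \<subseteq> gl_carrier A) \<longrightarrow> c vs = 0) \<and>
     (\<forall>vs i. \<forall>x\<in>gl_carrier A. \<forall>y\<in>gl_carrier A. length vs = k \<longrightarrow> set vs \<subseteq> gl_carrier A \<longrightarrow> i < k \<longrightarrow>
        c (vs[i := x + y]) = c (vs[i := x]) + c (vs[i := y])) \<and>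
     (\<forall>vs i a. \<forall>x\<in>gl_carrier A. length vs = k \<longrightarrow> set vs \<subseteq> gl_carrier A \<longrightarrow> i < k \<longrightarrow>
        c (vs[i := gl_scale A a x]) = a * c (vs[i := x])) \<and>
     (\<forall>vs. \<not> distinct vs \<longrightarrow> c vs = 0)}"

definition graded_cochains ::
    "('a::field, 'v::ab_group_add) graded_lie \<Rightarrow> nat \<Rightarrow> int \<Rightarrow> ('v list \<Rightarrow> 'a) set" where
  "graded_cochains A k g = {c \<in> cochains A k.
     \<forall>vs gs. length vs = k \<longrightarrow> length gs = k \<longrightarrow> (\<forall>i<k. vs ! i \<in> gl_comp A (gs ! i)) \<longrightarrow>
       sum_list gs \<noteq> g \<longrightarrow> c vs = 0}"

text \<open>
  The Chevalley--Eilenberg differential. Positions are counted from \<open>0\<close>; the sign agrees with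
  the one for positions counted from \<open>1\<close>, since both indices are shifted.
\<close>

definition ce_diff ::
    "('a::field, 'v::ab_group_add) graded_lie \<Rightarrow> ('v list \<Rightarrow> 'a) \<Rightarrow> 'v list \<Rightarrow> 'a" where
  "ce_diff A c vs = (if set vs \<subseteq> gl_carrier A then
     (\<Sum>(i, j)\<in>{(i, j). i < j \<and> j < length vs}.
        (-1) ^ (i + j) * c (gl_bracket A (vs ! i) (vs ! j) # nths vs (- {i, j})))
     else 0)"

definition cocycles ::
    "('a::field, 'v::ab_group_add) graded_lie \<Rightarrow> nat \<Rightarrow> int \<Rightarrow> ('v list \<Rightarrow> 'a) set" where
  "cocycles A k g = {c \<in> graded_cochains A k g. ce_diff A c = 0}"

definition coboundaries ::
    "('a::field, 'v::ab_group_add) graded_lie \<Rightarrow> nat \<Rightarrow> int \<Rightarrow> ('v list \<Rightarrow> 'a) set" where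
  "coboundaries A k g = (case k of 0 \<Rightarrow> {0} | Suc l \<Rightarrow> ce_diff A ` graded_cochains A l g)"

text \<open>
  The cohomology is the set of cosets of the coboundaries in the cocycles; its zero element is
  the coset \<open>coboundaries A k g\<close>.
\<close>

definition cohomology ::
    "('a::field, 'v::ab_group_add) graded_lie \<Rightarrow> nat \<Rightarrow> int \<Rightarrow> ('v list \<Rightarrow> 'a) set set" where
  "cohomology A k g = (\<lambda>c. (+) c ` coboundaries A k g) ` cocycles A k g"


section \<open>The truncated Poisson and Hamiltonian algebras\<close>

definition total_degree :: "mindex \<Rightarrow> nat" where
  "total_degree r = (\<Sum>i\<in>Poly_Mapping.keys r. Poly_Mapping.lookup r i)"

definition sym_grade :: "nat \<Rightarrow> mindex \<Rightarrow> int" where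
  "sym_grade m r = (\<Sum>i=1..m. int (Poly_Mapping.lookup r (i + m)) - int (Poly_Mapping.lookup r i))"

definition trunc_exps :: "nat \<Rightarrow> nat \<Rightarrow> mindex set" where
  "trunc_exps m p = {r. Poly_Mapping.keys r \<subseteq> {1..2 * m} \<and> (\<forall>i. Poly_Mapping.lookup r i < p)}"

definition po_exps :: "nat \<Rightarrow> nat \<Rightarrow> mindex set" where
  "po_exps m p = trunc_exps m p \<union> (\<lambda>i. Poly_Mapping.single i p) ` {1..2 * m}"

definition po2_exps :: "nat \<Rightarrow> nat \<Rightarrow> mindex set" where
  "po2_exps m p = {r \<in> trunc_exps m p. total_degree r < 2 * m * (p - 1)}"

definition span_alg ::
    "nat \<Rightarrow> mindex set \<Rightarrow> ('a dp \<Rightarrow> 'a dp \<Rightarrow> 'a dp) \<Rightarrow> ('a::field, 'a dp) graded_lie" where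
  "span_alg m S B = \<lparr>
     gl_scale = dp_scale,
     gl_carrier = dp.span (dp_monom ` S),
     gl_bracket = B,
     gl_comp = (\<lambda>g. dp.span (dp_monom ` {r \<in> S. sym_grade m r = g}))\<rparr>"

definition po_alg :: "nat \<Rightarrow> nat \<Rightarrow> ('a::field, 'a dp) graded_lie" where
  "po_alg m p = span_alg m (po_exps m p) (poisson m)"

definition po2_alg :: "nat \<Rightarrow> nat \<Rightarrow> ('a::field, 'a dp) graded_lie" where
  "po2_alg m p = span_alg m (po2_exps m p) (poisson m)"

text \<open>
  The quotients by the constants are represented on the span of the non-constant basis monomials,
  with the constant term of the bracket discarded.
\<close>

definition ham_alg :: "nat \<Rightarrow> nat \<Rightarrow> ('a::field, 'a dp) graded_lie" where
  "ham_alg m p = span_alg m (po_exps m p - {0}) (\<lambda>f h. drop_const (poisson m f h))"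

definition ham2_alg :: "nat \<Rightarrow> nat \<Rightarrow> ('a::field, 'a dp) graded_lie" where
  "ham2_alg m p = span_alg m (po2_exps m p - {0}) (\<lambda>f h. drop_const (poisson m f h))"

section \<open>The degenerate case of two indeterminates in characteristic two\<close>

text \<open>
  For \<open>m = 1\<close> and \<open>p = 2\<close> the algebras \<open>ham2_alg\<close> and \<open>po2_alg\<close> do not contain \<open>x\<^sub>1 x\<^sub>2\<close>: the former
  is the two-dimensional abelian algebra and the latter the Heisenberg algebra, and the coefficient
  of \<open>x\<^sub>2\<close> is a non-trivial 1-cocycle of grade \<open>1\<close>, which is not a multiple of \<open>2\<close>. The main
  statement is therefore false for these two algebras and excludes them.
\<close>

abbreviation "unit_exp i \<equiv> (Poly_Mapping.single i 1 :: mindex)"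

lemma po2_exps_1_2: "po2_exps 1 2 = {0, unit_exp 1, unit_exp 2}"
proof -
  have deg: "total_degree r = Poly_Mapping.lookup r 1 + Poly_Mapping.lookup r 2" if "Poly_Mapping.keys r \<subseteq> {1..2}" for r
  proof -
    have "total_degree r = (\<Sum>i\<in>{1..2}. Poly_Mapping.lookup r i)"
      unfolding total_degree_def by (rule sum.mono_neutral_left) (use that in \<open>auto simp: in_keys_iff\<close>)
    also have "{1..2::nat} = {1,2}" by auto
    finally show ?thesis by simp
  qed
  have "r \<in> {0, unit_exp 1, unit_exp 2}" if k: "Poly_Mapping.keys r \<subseteq> {1..2}" and d: "Poly_Mapping.lookup r 1 + Poly_Mapping.lookup r 2 < 2" for r :: mindex
  proof -
    have o: "Poly_Mapping.lookup r i = 0" if "i \<noteq> 1" "i \<noteq> 2" for i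
    proof -
      have "i \<notin> {1..2::nat}" using that by auto
      with k show ?thesis by (auto simp: in_keys_iff subset_iff)
    qed
    consider "Poly_Mapping.lookup r 1 = 0" "Poly_Mapping.lookup r 2 = 0" | "Poly_Mapping.lookup r 1 = 1" "Poly_Mapping.lookup r 2 = 0"
      | "Poly_Mapping.lookup r 1 = 0" "Poly_Mapping.lookup r 2 = 1" using d by linarith
    then show ?thesis
    proof cases
      case 1 then have "r = 0" by (intro poly_mapping_eqI) (metis o lookup_zero)
      then show ?thesis by simp
    next
      case 2 then have "r = unit_exp 1" by (intro poly_mapping_eqI) (metis o lookup_single_eq lookup_single_not_eq)
      then show ?thesis by simp
    next
      case 3 then have "r = unit_exp 2" by (intro poly_mapping_eqI) (metis o lookup_single_eq lookup_single_not_eq)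
      then show ?thesis by simp
    qed
  qed
  moreover have "{0, unit_exp 1, unit_exp 2} \<subseteq> po2_exps 1 2"
    by (auto simp: po2_exps_def trunc_exps_def total_degree_def lookup_single Poly_Mapping.when_def)
  moreover have "Poly_Mapping.keys r \<subseteq> {1..2}" "Poly_Mapping.lookup r 1 + Poly_Mapping.lookup r 2 < 2" if "r \<in> po2_exps 1 2" for r
    using that deg[of r] by (auto simp: po2_exps_def trunc_exps_def)
  ultimately show ?thesis by blast
qed

lemma poisson_const:
  assumes "Poly_Mapping.keys f \<subseteq> {0, unit_exp 1, unit_exp 2}" "Poly_Mapping.keys h \<subseteq> {0, unit_exp 1, unit_exp 2}"
  shows "Poly_Mapping.keys (poisson 1 f h) \<subseteq> {0}"
proof -
  have sumk: "Poly_Mapping.keys (sum F I) \<subseteq> {0}" if "\<And>i. i \<in> I \<Longrightarrow> Poly_Mapping.keys (F i) \<subseteq> {0}" for F :: "_ \<Rightarrow> 'a dp" and I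
    using that by (force simp: in_keys_iff lookup_sum subset_iff intro: sum.neutral)
  have D: "Poly_Mapping.keys (dp_deriv i f) \<subseteq> {0}" if "Poly_Mapping.keys f \<subseteq> {0, unit_exp 1, unit_exp 2}" for i and f :: "'a dp"
    unfolding dp_deriv_def
  proof (rule sumk)
    fix r assume "r \<in> {r \<in> Poly_Mapping.keys f. 0 < Poly_Mapping.lookup r i}"
    then have "r - unit_exp i = 0" using that
      by (auto simp: lookup_single Poly_Mapping.when_def split: if_splits)
    then show "Poly_Mapping.keys (dp_scale (Poly_Mapping.lookup f r) (dp_monom (r - unit_exp i))) \<subseteq> {0}"
      using keys_scale_monom by metis
  qed
  have M: "Poly_Mapping.keys (dp_mult u v) \<subseteq> {0}" if "Poly_Mapping.keys u \<subseteq> {0}" "Poly_Mapping.keys v \<subseteq> {0}" for u v :: "'a dp"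
    unfolding dp_mult_def
  proof (intro sumk)
    fix r s assume "r \<in> Poly_Mapping.keys u" "s \<in> Poly_Mapping.keys v"
    with that have "r = 0" "s = 0" by blast+
    then have "r + s = 0" by simp
    then show "Poly_Mapping.keys (dp_scale (Poly_Mapping.lookup u r * Poly_Mapping.lookup v s * of_nat (mbinomial (r + s) r)) (dp_monom (r + s))) \<subseteq> {0}"
      using keys_scale_monom by metis
  qed
  have minusk: "Poly_Mapping.keys (u - v) \<subseteq> {0}" if "Poly_Mapping.keys u \<subseteq> {0}" "Poly_Mapping.keys v \<subseteq> {0}" for u v :: "'a dp"
  proof
    fix t assume "t \<in> Poly_Mapping.keys (u - v)"
    then have "t \<in> Poly_Mapping.keys u \<or> t \<in> Poly_Mapping.keys v"
      by (auto simp: in_keys_iff lookup_minus)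
    with that show "t \<in> {0}" by blast
  qed
  show ?thesis unfolding poisson_def
    using assms by (intro sumk minusk M D)
qed

lemma degenerate_cohomology_nonzero:
  fixes A :: "('a::field, 'a dp) graded_lie"
  assumes "A \<in> {ham2_alg 1 2, po2_alg 1 2}"
  shows "cohomology A 1 1 \<noteq> {coboundaries A 1 1}"
proof -
  have e0: "unit_exp 2 \<noteq> 0" by (metis lookup_single_eq lookup_zero zero_neq_one)
  define S where "S = (if A = po2_alg 1 2 then po2_exps 1 2 else po2_exps 1 2 - {0})"
  define c :: "'a dp list \<Rightarrow> 'a" where
    "c vs = (if length vs = 1 \<and> set vs \<subseteq> gl_carrier A then Poly_Mapping.lookup (hd vs) (unit_exp 2) else 0)" for vs
  have carr: "gl_carrier A = {f. Poly_Mapping.keys f \<subseteq> S}" and sc: "gl_scale A = dp_scale"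
    and comp: "gl_comp A g = {f. Poly_Mapping.keys f \<subseteq> {r \<in> S. sym_grade 1 r = g}}" for g
    using assms by (auto simp: ham2_alg_def po2_alg_def span_alg_def span_dp_monom S_def)
  have sub: "S \<subseteq> {0, unit_exp 1, unit_exp 2}" "unit_exp 2 \<in> S" using e0 unfolding S_def po2_exps_1_2 by (auto split: if_splits simp del: One_nat_def)
  have add: "x + y \<in> gl_carrier A" if "x \<in> gl_carrier A" "y \<in> gl_carrier A" for x y
    using that Poly_Mapping.keys_add[of x y] unfolding carr by blast
  have scl: "gl_scale A a x \<in> gl_carrier A" if "x \<in> gl_carrier A" for a x
    using that unfolding carr sc by (auto simp: in_keys_iff subset_iff)
  have c1: "c [v] = Poly_Mapping.lookup v (unit_exp 2)" if "v \<in> gl_carrier A" for v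
    using that by (simp add: c_def)
  have ext: "c vs = 0" if "\<not> (length vs = 1 \<and> set vs \<subseteq> gl_carrier A)" for vs
    using that unfolding c_def by (rule if_not_P)
  have coch: "c \<in> cochains A 1"
    unfolding cochains_def mem_Collect_eq
  proof (intro conjI allI ballI impI)
    fix vs :: "'a dp list" and i x y
    assume *: "x \<in> gl_carrier A" "y \<in> gl_carrier A" "length vs = 1" "i < (1::nat)"
    then obtain v where "vs = [v]" by (cases vs) auto
    with * show "c (vs[i := x + y]) = c (vs[i := x]) + c (vs[i := y])"
      by (simp add: c1 add lookup_add)
  next
    fix vs :: "'a dp list" and i a x
    assume *: "x \<in> gl_carrier A" "length vs = 1" "i < (1::nat)"
    then obtain v where "vs = [v]" by (cases vs) auto
    with * show "c (vs[i := gl_scale A a x]) = a * c (vs[i := x])"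
      by (simp add: c1 scl) (simp add: sc)
  next
    fix vs :: "'a dp list" assume "\<not> distinct vs"
    then have "length vs \<noteq> 1" by (cases vs) auto
    then show "c vs = 0" by (simp add: ext)
  qed (rule ext)
  have gr: "c \<in> graded_cochains A 1 1"
    unfolding graded_cochains_def mem_Collect_eq
  proof (intro conjI coch allI impI)
    fix vs :: "'a dp list" and gs :: "int list"
    assume *: "length vs = 1" "length gs = 1" "\<forall>i<1. vs ! i \<in> gl_comp A (gs ! i)" "sum_list gs \<noteq> 1"
    obtain v where v: "vs = [v]" using * by (cases vs) auto
    obtain g where g: "gs = [g]" using * by (cases gs) auto
    have "sym_grade 1 (unit_exp 2) = 1" by (simp add: sym_grade_def lookup_single)
    then have "unit_exp 2 \<notin> Poly_Mapping.keys v" using * by (auto simp: v g comp)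
    then show "c vs = 0" by (simp add: v c_def in_keys_iff)
  qed
  have br: "c [gl_bracket A x y] = 0" if "x \<in> gl_carrier A" "y \<in> gl_carrier A" for x y
  proof -
    have "Poly_Mapping.keys (poisson 1 x y) \<subseteq> {0}"
      using that sub unfolding carr by (intro poisson_const) blast+
    with e0 have z: "Poly_Mapping.lookup (poisson 1 x y) (unit_exp 2) = 0" "Poly_Mapping.lookup (drop_const (poisson 1 x y)) (unit_exp 2) = 0"
      by (auto simp: drop_const_def lookup_minus dp_monom_def lookup_single_not_eq in_keys_iff subset_iff simp del: single_one)
    have "gl_bracket A x y \<in> {poisson 1 x y, drop_const (poisson 1 x y)}"
      using assms by (auto simp: ham2_alg_def po2_alg_def span_alg_def)
    with z show ?thesis by (auto simp: c_def)
  qed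
  have "ce_diff A c vs = 0" for vs
  proof (cases "length vs = 2 \<and> set vs \<subseteq> gl_carrier A")
    case True
    then obtain x y where vs: "vs = [x, y]" by (auto simp: length_Suc_conv numeral_2_eq_2)
    have "{(i, j). i < j \<and> j < length vs} = {(0::nat, 1::nat)}" by (auto simp: vs)
    then show ?thesis using True br[of x y] by (simp add: ce_diff_def vs nths_Cons)
  next
    case False
    show ?thesis
    proof (cases "set vs \<subseteq> gl_carrier A")
      case True
      with False have l: "length vs \<noteq> 2" by simp
      have "c (b # nths vs (- {i, j})) = 0" if "i < j" "j < length vs" for b i j
      proof -
        have "{k. k < length vs \<and> k \<in> - {i, j}} = {..<length vs} - {i, j}" by auto
        then have "length (nths vs (- {i, j})) = length vs - 2"
          using that by (simp add: length_nths card_Diff_subset)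
        moreover have "length vs > 2" using that l by linarith
        ultimately show ?thesis by (simp add: ext)
      qed
      then show ?thesis unfolding ce_diff_def by (auto intro!: sum.neutral)
    qed (simp add: ce_diff_def)
  qed
  then have cz: "c \<in> cocycles A 1 1" using gr by (auto simp: cocycles_def)
  have "ce_diff A b = 0" if "b \<in> graded_cochains A 0 1" for b
  proof
    fix vs
    have b1: "\<forall>vs. \<not> (length vs = 0 \<and> set vs \<subseteq> gl_carrier A) \<longrightarrow> b vs = 0"
      using that unfolding graded_cochains_def cochains_def mem_Collect_eq by (elim conjE)
    have b0: "b (u # us) = 0" for u us
      by (rule b1[rule_format]) simp
    show "ce_diff A b vs = 0 vs" unfolding ce_diff_def by (auto intro!: sum.neutral simp: b0)
  qed
  then have cb: "coboundaries A 1 1 \<subseteq> {0}" by (auto simp: coboundaries_def)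
  have z0: "0 \<in> graded_cochains A 0 1"
    unfolding graded_cochains_def cochains_def mem_Collect_eq zero_fun_def by (intro conjI) simp_all
  have "coboundaries A 1 1 \<noteq> {}" using z0 by (auto simp: coboundaries_def)
  with cb have B: "coboundaries A 1 1 = {0}" by blast
  have "c [dp_monom (unit_exp 2)] = 1"
    using sub(2) by (simp add: c1 carr dp_monom_def)
  then have "c \<noteq> 0" by auto
  have "(+) c ` coboundaries A 1 1 \<in> cohomology A 1 1"
    unfolding cohomology_def using cz by blast
  then have "{c} \<in> cohomology A 1 1" by (simp only: B image_insert image_empty add_0_right)
  with \<open>c \<noteq> 0\<close> show ?thesis unfolding B by (metis singletonD singleton_iff)
qed

end

theory Submission
  imports Defs
begin

text \<open>
  The grading is inner up to multiples of \<open>p\<close>: for \<open>e = \<Sum>i. x\<^sub>i x\<^sub>i\<^sub>+\<^sub>m\<close>, which has grade \<open>0\<close>, the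
  operator \<open>{e, _}\<close> multiplies every monomial by its grade. Cartan's formula
  \<open>d \<iota>\<^sub>e + \<iota>\<^sub>e d = \<plusminus> L\<^sub>e\<close>, where \<open>L\<^sub>e\<close> is multiplication by \<open>g\<close> on cochains of grade \<open>g\<close>, then
  makes \<open>g\<^sup>-\<^sup>1 \<iota>\<^sub>e\<close> a contracting homotopy up to sign whenever \<open>g\<close> is invertible in \<open>F\<close>.
  In every algebra except the two excluded ones, \<open>e\<close> has small enough degree to be an element.
\<close>

section \<open>Cochains\<close>

lemma nths_Compl_singleton: "j < length vs \<Longrightarrow> nths vs (- {j}) = take j vs @ drop (Suc j) vs"
proof (induction vs arbitrary: j)
  case (Cons v vs)
  show ?case
  proof (cases j)
    case 0
    have "{k. Suc k \<in> - {0}} = UNIV" by auto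
    then show ?thesis using 0 by (simp add: nths_Cons nths_all)
  next
    case (Suc l)
    have "{k. Suc k \<in> - {Suc l}} = - {l}" by auto
    then show ?thesis using Suc Cons by (simp add: nths_Cons)
  qed
qed simp

context
  fixes A :: "('a::field, 'v::ab_group_add) graded_lie" and c :: "'v list \<Rightarrow> 'a" and k :: nat
  assumes c: "c \<in> cochains A k"
begin

lemma cochain_ext: "\<not> (length vs = k \<and> set vs \<subseteq> gl_carrier A) \<Longrightarrow> c vs = 0"
  using c unfolding cochains_def by blast

lemma cochain_add:
  "\<lbrakk>x \<in> gl_carrier A; y \<in> gl_carrier A; length vs = k; set vs \<subseteq> gl_carrier A; i < k\<rbrakk>
    \<Longrightarrow> c (vs[i := x + y]) = c (vs[i := x]) + c (vs[i := y])"
  using c unfolding cochains_def by blast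

lemma cochain_scale:
  "\<lbrakk>x \<in> gl_carrier A; length vs = k; set vs \<subseteq> gl_carrier A; i < k\<rbrakk>
    \<Longrightarrow> c (vs[i := gl_scale A a x]) = a * c (vs[i := x])"
  using c unfolding cochains_def by blast

lemma cochain_alternating: "\<not> distinct vs \<Longrightarrow> c vs = 0"
  using c unfolding cochains_def by blast

text \<open>Expand \<open>c\<close> with \<open>x + y\<close> in both slots: the whole and the two
  diagonal terms vanish by alternation, which gives the sign in every characteristic. Closure under
  addition makes \<open>x + y\<close> an admissible argument; on ill-formed lists both sides are
  \<open>0\<close>.\<close>

lemma cochain_swap:
  assumes add: "\<And>x y. x \<in> gl_carrier A \<Longrightarrow> y \<in> gl_carrier A \<Longrightarrow> x + y \<in> gl_carrier A"
  shows "c (us @ x # y # ws) = - c (us @ y # x # ws)"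
proof (cases "length (us @ x # y # ws) = k \<and> set (us @ x # y # ws) \<subseteq> gl_carrier A")
  case True
  then have x: "x \<in> gl_carrier A" and y: "y \<in> gl_carrier A" and ca: "set us \<subseteq> gl_carrier A" "set ws \<subseteq> gl_carrier A"
    and len: "k = Suc (Suc (length us + length ws))" by auto
  have fst_add: "c (us @ (x + y) # z # ws) = c (us @ x # z # ws) + c (us @ y # z # ws)"
    if "z \<in> gl_carrier A" for z
    using cochain_add[of x y "us @ x # z # ws" "length us"] that x y ca len by simp
  have snd_add: "c (us @ z # (x + y) # ws) = c (us @ z # x # ws) + c (us @ z # y # ws)"
    if "z \<in> gl_carrier A" for z
    using cochain_add[of x y "us @ z # x # ws" "Suc (length us)"] that x y ca len
    by (simp add: list_update_append)
  have eq: "c (us @ z # z # ws) = 0" for z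
    by (rule cochain_alternating) simp
  have "0 = c (us @ (x + y) # (x + y) # ws)"
    by (simp add: eq)
  also have "\<dots> = c (us @ x # y # ws) + c (us @ y # x # ws)"
    using x y by (simp only: fst_add[OF add] snd_add) (simp add: eq)
  finally show ?thesis
    by (simp add: eq_neg_iff_add_eq_0)
next
  case False
  then have "\<not> (length (us @ y # x # ws) = k \<and> set (us @ y # x # ws) \<subseteq> gl_carrier A)" by auto
  then have "c (us @ y # x # ws) = 0" by (rule cochain_ext)
  moreover have "c (us @ x # y # ws) = 0" using False by (rule cochain_ext)
  ultimately show ?thesis by simp
qed

text \<open>\<open>x\<close> passes the entries of \<open>us\<close> by adjacent swaps, one sign
  each; the prefix \<open>ps\<close> grows in the induction.\<close>

lemma cochain_move:
  assumes "\<And>x y. x \<in> gl_carrier A \<Longrightarrow> y \<in> gl_carrier A \<Longrightarrow> x + y \<in> gl_carrier A"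
  shows "c (ps @ x # us @ ws) = (- 1) ^ length us * c (ps @ us @ x # ws)"
proof (induction us arbitrary: ps)
  case (Cons u us)
  show ?case
    using cochain_swap[OF assms, of ps x u "us @ ws"] Cons[of "ps @ [u]"] by simp
qed simp

end

section \<open>Coboundaries and vanishing cohomology\<close>

lemma graded_cochains_zero: "0 \<in> graded_cochains A k g"
  unfolding graded_cochains_def cochains_def by auto

lemma graded_cochains_diff:
  assumes "b \<in> graded_cochains A k g" "c \<in> graded_cochains A k g"
  shows "b - c \<in> graded_cochains A k g"
  using assms unfolding graded_cochains_def cochains_def by (simp add: algebra_simps)

lemma ce_diff_zero: "ce_diff A 0 = 0"
  by (rule ext) (simp add: ce_diff_def)

lemma ce_diff_diff: "ce_diff A (b - c) = ce_diff A b - ce_diff A c"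
  by (rule ext) (simp add: ce_diff_def algebra_simps case_prod_unfold sum_subtractf)

lemma coboundaries_zero: "0 \<in> coboundaries A k g"
  unfolding coboundaries_def
  by (cases k) (auto intro!: image_eqI[OF _ graded_cochains_zero] simp: ce_diff_zero)

lemma coboundaries_diff:
  "b \<in> coboundaries A k g \<Longrightarrow> c \<in> coboundaries A k g \<Longrightarrow> b - c \<in> coboundaries A k g"
  unfolding coboundaries_def
  by (cases k) (auto simp flip: ce_diff_diff intro!: imageI graded_cochains_diff)

text \<open>Coboundaries form an additive group, so translating them by one of their members returns
  the same set. The zero cocycle ensures that this coset occurs.\<close>

lemma cohomology_trivial:
  assumes "cocycles A k g \<subseteq> coboundaries A k g"
  shows "cohomology A k g = {coboundaries A k g}"
proof -
  have "(+) c ` coboundaries A k g = coboundaries A k g" if "c \<in> cocycles A k g" for c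
  proof -
    have c: "c \<in> coboundaries A k g" using that assms by blast
    have neg: "- b \<in> coboundaries A k g" if "b \<in> coboundaries A k g" for b
      using coboundaries_diff[OF coboundaries_zero that] by simp
    have "c + b \<in> coboundaries A k g" if "b \<in> coboundaries A k g" for b
      using coboundaries_diff[OF c neg[OF that]] by simp
    moreover have "b \<in> (+) c ` coboundaries A k g" if "b \<in> coboundaries A k g" for b
      using coboundaries_diff[OF that c] by (intro image_eqI[of _ _ "b - c"]) simp_all
    ultimately show ?thesis by blast
  qed
  moreover have "0 \<in> cocycles A k g"
    by (simp add: cocycles_def graded_cochains_zero ce_diff_zero)
  ultimately show ?thesis unfolding cohomology_def by blast
qed


section \<open>Gradings induced by an inner derivation\<close>

text \<open>Common abstraction of the algebras: bracketing with \<open>e\<close> is linear and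
  multiplies each vector of the spanning set \<open>B\<close> by the image of its grade in the
  field.\<close>

locale inner_graded_lie = vector_space "gl_scale A"
  for A :: "('a::field, 'v::ab_group_add) graded_lie" +
  fixes e :: 'v and B :: "'v set"
  assumes carrier_eq: "gl_carrier A = span B"
    and e_carrier: "e \<in> gl_carrier A"
    and e_comp: "e \<in> gl_comp A 0"
    and bracket_e_add: "gl_bracket A e (x + y) = gl_bracket A e x + gl_bracket A e y"
    and bracket_e_scale: "gl_bracket A e (gl_scale A a x) = gl_scale A a (gl_bracket A e x)"
    and bracket_e_basis:
      "b \<in> B \<Longrightarrow> \<exists>h. b \<in> gl_comp A h \<and> gl_bracket A e b = gl_scale A (of_int h) b"
begin

lemma carrier_add: "x \<in> gl_carrier A \<Longrightarrow> y \<in> gl_carrier A \<Longrightarrow> x + y \<in> gl_carrier A"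
  and carrier_scale: "x \<in> gl_carrier A \<Longrightarrow> gl_scale A a x \<in> gl_carrier A"
  and carrier_zero: "0 \<in> gl_carrier A"
  by (auto simp: carrier_eq span_add span_scale span_zero)

lemma bracket_e_zero: "gl_bracket A e 0 = 0"
  using bracket_e_add[of 0 0] by simp

text \<open>Vectors of \<open>B\<close> are eigenvectors of bracketing with \<open>e\<close>, so
  their span is stable. Cochains are multilinear only on the carrier, hence the need for
  this.\<close>

lemma bracket_e_carrier: "x \<in> gl_carrier A \<Longrightarrow> gl_bracket A e x \<in> gl_carrier A"
  unfolding carrier_eq
proof (induction rule: span_induct_alt)
  case base
  then show ?case by (simp add: bracket_e_zero span_zero)
next
  case (step a x y)
  then obtain h where h: "gl_bracket A e x = gl_scale A (of_int h) x"
    using bracket_e_basis by blast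
  have "gl_scale A a (gl_bracket A e x) \<in> span B"
    unfolding h using step by (intro span_scale span_base)
  then show ?case
    using step unfolding bracket_e_add bracket_e_scale by (intro span_add)
qed

text \<open>Both sides are multilinear in \<open>vs\<close>. On vectors of \<open>B\<close> the left
  side is the sum of their grades times \<open>c vs\<close>, and \<open>c\<close> vanishes unless
  that sum is \<open>g\<close>.\<close>

lemma lie_derivative_eq:
  assumes c: "c \<in> graded_cochains A k g" and "length vs = k" "set vs \<subseteq> gl_carrier A"
  shows "(\<Sum>j<k. c (vs[j := gl_bracket A e (vs ! j)])) = of_int g * c vs"
proof -
  define P where "P vs \<longleftrightarrow> (\<Sum>j<k. c (vs[j := gl_bracket A e (vs ! j)])) = of_int g * c vs" for vs
  have cc: "c \<in> cochains A k" using c by (simp add: graded_cochains_def)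
  note cadd = cochain_add[OF cc] and cscale = cochain_scale[OF cc]
  have upd: "set (us[i := x]) \<subseteq> gl_carrier A" if "set us \<subseteq> gl_carrier A" "x \<in> gl_carrier A" for us i x
    using that set_update_subset_insert[of us i x] by blast
  \<comment> \<open>Slot \<open>i\<close> is singled out because there the bracket hits the varying
    argument; every other update commutes with the one at \<open>i\<close>.\<close>
  have split_at: "(\<Sum>j<k. c (us[i := x, j := gl_bracket A e (us[i := x] ! j)]))
      = c (us[i := gl_bracket A e x]) + (\<Sum>j\<in>{..<k} - {i}. c (us[j := gl_bracket A e (us ! j), i := x]))"
    if "length us = k" "i < k" for us i x
  proof -
    have "(\<Sum>j\<in>{..<k} - {i}. c (us[i := x, j := gl_bracket A e (us[i := x] ! j)]))
        = (\<Sum>j\<in>{..<k} - {i}. c (us[j := gl_bracket A e (us ! j), i := x]))"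
      by (rule sum.cong) (auto simp: list_update_swap)
    then show ?thesis using that by (subst sum.remove[of _ i]) auto
  qed
  have P_step: "P (us[i := gl_scale A a x + y])"
    if us: "length us = k" "set us \<subseteq> gl_carrier A" "i < k" and x: "x \<in> gl_carrier A" and y: "y \<in> gl_carrier A"
      and "P (us[i := x])" "P (us[i := y])" for us i a x y
  proof -
    have lin: "c (ws[i := gl_scale A a u + w]) = a * c (ws[i := u]) + c (ws[i := w])"
      if "length ws = k" "set ws \<subseteq> gl_carrier A" "u \<in> gl_carrier A" "w \<in> gl_carrier A" for ws u w
      using that \<open>i < k\<close> by (simp add: cadd cscale carrier_scale)
    have us_j: "set (us[j := gl_bracket A e (us ! j)]) \<subseteq> gl_carrier A" if "j < k" for j
      using that us by (intro upd bracket_e_carrier) auto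
    have s: "(\<Sum>j\<in>{..<k} - {i}. c (us[j := gl_bracket A e (us ! j), i := gl_scale A a x + y]))
        = a * (\<Sum>j\<in>{..<k} - {i}. c (us[j := gl_bracket A e (us ! j), i := x]))
          + (\<Sum>j\<in>{..<k} - {i}. c (us[j := gl_bracket A e (us ! j), i := y]))"
      using us x y us_j by (simp add: lin sum.distrib sum_distrib_left)
    have d: "c (us[i := gl_bracket A e (gl_scale A a x + y)])
        = a * c (us[i := gl_bracket A e x]) + c (us[i := gl_bracket A e y])"
      using us x y by (simp add: bracket_e_add bracket_e_scale lin bracket_e_carrier)
    have t: "c (us[i := gl_scale A a x + y]) = a * c (us[i := x]) + c (us[i := y])"
      using us x y by (simp add: lin)
    have combine: "d + s = q * t" if "s = a * s1 + s2" "d = a * d1 + d2" "t = a * t1 + t2"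
      "d1 + s1 = q * t1" "d2 + s2 = q * t2" for d d1 d2 s s1 s2 t t1 t2 q :: 'a
    proof -
      have "d + s = a * (d1 + s1) + (d2 + s2)" by (simp add: that(1,2) algebra_simps)
      then show ?thesis by (simp only: that(3-5)) (simp add: algebra_simps)
    qed
    show ?thesis
      unfolding P_def split_at[OF us(1,3)]
      by (rule combine[OF s d t that(6,7)[unfolded P_def split_at[OF us(1,3)]]])
  qed
  have P_zero: "P (us[i := 0])" if us: "length us = k" "set us \<subseteq> gl_carrier A" "i < k" for us i
  proof -
    have z: "c (ws[i := 0]) = 0" if "length ws = k" "set ws \<subseteq> gl_carrier A" for ws
      using cscale[OF carrier_zero that us(3), of 0] by simp
    have "set (us[j := gl_bracket A e (us ! j)]) \<subseteq> gl_carrier A" if "j < k" for j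
      using that us by (intro upd bracket_e_carrier) auto
    then show ?thesis unfolding P_def using us by (simp add: split_at bracket_e_zero z)
  qed
  have P_basis: "P us" if us: "length us = k" "set us \<subseteq> B" for us
  proof -
    have usc: "set us \<subseteq> gl_carrier A" using us(2) span_superset carrier_eq by blast
    have "\<forall>b\<in>B. \<exists>h. b \<in> gl_comp A h \<and> gl_bracket A e b = gl_scale A (of_int h) b"
      using bracket_e_basis by blast
    then obtain h where h: "\<And>b. b \<in> B \<Longrightarrow> b \<in> gl_comp A (h b) \<and> gl_bracket A e b = gl_scale A (of_int (h b)) b"
      by metis
    have usB: "us ! j \<in> B" if "j < k" for j using that us by auto
    have "c (us[j := gl_bracket A e (us ! j)]) = of_int (h (us ! j)) * c us" if "j < k" for j
      using that us usc usB h cscale[of "us ! j" us j "of_int (h (us ! j))"] by (auto simp: subset_iff)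
    then have "(\<Sum>j<k. c (us[j := gl_bracket A e (us ! j)])) = of_int (\<Sum>j<k. h (us ! j)) * c us"
      by (simp add: sum_distrib_right)
    also have "(\<Sum>j<k. h (us ! j)) = sum_list (map h us)"
      using us(1) by (simp add: sum_list_sum_nth atLeast0LessThan)
    also have "of_int (sum_list (map h us)) * c us = of_int g * c us"
    \<comment> \<open>The scalars may differ when the grades do not add up to \<open>g\<close>, but
      then \<open>c us\<close> is \<open>0\<close>.\<close>
    proof (cases "sum_list (map h us) = g")
      case False
      have "length (map h us) = k" "\<forall>i<k. us ! i \<in> gl_comp A (map h us ! i)"
        using us(1) usB h by auto
      with c us(1) False have "c us = 0" unfolding graded_cochains_def by blast
      then show ?thesis by simp
    qed simp
    finally show ?thesis by (simp add: P_def)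
  qed
  \<comment> \<open>Multilinear extension: \<open>n\<close> counts the leading arguments that need not be basis vectors.\<close>
  have "n \<le> k \<Longrightarrow> P us" if "length us = k" "set us \<subseteq> gl_carrier A" "set (drop n us) \<subseteq> B" for n us
    using that
  proof (induction n arbitrary: us)
    case 0
    then show ?case by (intro P_basis) auto
  next
    case (Suc n)
    \<comment> \<open>Membership is carried along because the induction step must know that the tail
      \<open>y\<close> lies in the carrier before \<open>P_step\<close> applies.\<close>
    have "x \<in> gl_carrier A \<and> P (us[n := x])" if "x \<in> span B" for x
      using that
    proof (induction rule: span_induct_alt)
      case base
      have "P (us[n := 0])" using Suc.prems by (intro P_zero) auto
      then show ?case using carrier_zero by blast
    next
      case (step a x y)
      have "x \<in> gl_carrier A" using step span_base carrier_eq by blast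
      moreover have "P (us[n := x])"
      proof (rule Suc.IH)
        show "set (drop n (us[n := x])) \<subseteq> B"
          using Suc.prems step by (simp add: drop_update_swap flip: Cons_nth_drop_Suc)
      qed (use Suc.prems upd \<open>x \<in> gl_carrier A\<close> in auto)
      ultimately have "P (us[n := gl_scale A a x + y])" using Suc.prems step by (intro P_step) auto
      then show ?case using \<open>x \<in> gl_carrier A\<close> step carrier_add carrier_scale by blast
    qed
    moreover have "us ! n \<in> span B" using Suc.prems carrier_eq by auto
    ultimately have "P (us[n := us ! n])" by blast
    then show ?case by simp
  qed
  from this[of vs k] assms show ?thesis by (simp add: P_def)
qed

section \<open>Contraction by \<open>e\<close> and Cartan's formula\<close>

lemma contraction_graded_cochain:
  assumes "c \<in> graded_cochains A (Suc k) g"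
  shows "(\<lambda>vs. a * c (e # vs)) \<in> graded_cochains A k g"
proof -
  have cc: "c \<in> cochains A (Suc k)" using assms by (simp add: graded_cochains_def)
  have "c (e # vs) = 0"
    if "length vs = k" "length gs = k" "\<forall>i<k. vs ! i \<in> gl_comp A (gs ! i)" "sum_list gs \<noteq> g" for vs gs
  proof -
    \<comment> \<open>\<open>e\<close> has grade \<open>0\<close>, so putting it in front does not
      change the sum of the grades.\<close>
    have "\<forall>i<Suc k. (e # vs) ! i \<in> gl_comp A ((0 # gs) ! i)"
      using that(3) e_comp by (simp add: nth_Cons split: nat.split)
    moreover have "length (e # vs) = Suc k" "length (0 # gs) = Suc k" "sum_list (0 # gs) \<noteq> g"
      using that by auto
    ultimately show ?thesis using assms unfolding graded_cochains_def by blast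
  qed
  moreover have "c (e # vs) = 0" if "\<not> (length vs = k \<and> set vs \<subseteq> gl_carrier A)" for vs
    using that by (intro cochain_ext[OF cc]) auto
  moreover have "c (e # vs[i := x + y]) = c (e # vs[i := x]) + c (e # vs[i := y])"
    if "x \<in> gl_carrier A" "y \<in> gl_carrier A" "length vs = k" "set vs \<subseteq> gl_carrier A" "i < k" for vs i x y
    using cochain_add[OF cc, of x y "e # vs" "Suc i"] that e_carrier by simp
  moreover have "c (e # vs[i := gl_scale A s x]) = s * c (e # vs[i := x])"
    if "x \<in> gl_carrier A" "length vs = k" "set vs \<subseteq> gl_carrier A" "i < k" for vs i s x
    using cochain_scale[OF cc, of x "e # vs" "Suc i"] that e_carrier by simp
  moreover have "c (e # vs) = 0" if "\<not> distinct vs" for vs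
    using that by (intro cochain_alternating[OF cc]) auto
  ultimately show ?thesis
    unfolding graded_cochains_def cochains_def by (auto simp: algebra_simps)
qed

text \<open>The index pairs of \<open>e # vs\<close> split into those starting at \<open>0\<close>,
  where \<open>e\<close> is bracketed with an argument, and the shifted pairs of \<open>vs\<close>,
  where \<open>e\<close> survives as an argument. The former give the Lie derivative, the latter the
  differential of the contraction.\<close>

lemma cartan_formula:
  assumes c: "c \<in> cochains A k" and vs: "set vs \<subseteq> gl_carrier A"
  shows "ce_diff A c (e # vs) = - (\<Sum>j<length vs. c (vs[j := gl_bracket A e (vs ! j)]))
    - ce_diff A (\<lambda>us. c (e # us)) vs"
proof -
  define n where "n = length vs"
  define F where "F = (\<lambda>(i, j). (- 1) ^ (i + j) *
    c (gl_bracket A ((e # vs) ! i) ((e # vs) ! j) # nths (e # vs) (- {i, j})))"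
  define I where "I = {(i, j). i < j \<and> j < n}"
  have fin: "finite I" by (rule finite_subset[of _ "{..<n} \<times> {..<n}"]) (auto simp: I_def)
  have "{(i, j). i < j \<and> j < length (e # vs)} = (\<lambda>j. (0, Suc j)) ` {..<n} \<union> map_prod Suc Suc ` I"
  proof (intro equalityI subsetI)
    fix q assume "q \<in> {(i, j). i < j \<and> j < length (e # vs)}"
    then obtain i j where q: "q = (i, Suc j)" "i \<le> j" "j < n"
      by (cases q; cases "snd q") (auto simp: n_def)
    then show "q \<in> (\<lambda>j. (0, Suc j)) ` {..<n} \<union> map_prod Suc Suc ` I"
      by (cases i) (auto simp: I_def image_iff)
  qed (auto simp: I_def n_def)
  then have "ce_diff A c (e # vs) = sum F ((\<lambda>j. (0, Suc j)) ` {..<n} \<union> map_prod Suc Suc ` I)"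
    using vs e_carrier by (simp add: ce_diff_def F_def)
  also have "\<dots> = sum F ((\<lambda>j. (0, Suc j)) ` {..<n}) + sum F (map_prod Suc Suc ` I)"
    using fin by (intro sum.union_disjoint) auto
  also have "sum F ((\<lambda>j. (0, Suc j)) ` {..<n}) = (\<Sum>j<n. F (0, Suc j))"
    by (subst sum.reindex) (auto simp: inj_on_def)
  also have "\<dots> = (\<Sum>j<n. - c (vs[j := gl_bracket A e (vs ! j)]))"
  proof (rule sum.cong)
    fix j assume "j \<in> {..<n}"
    then have j: "j < length vs" by (simp add: n_def)
    have "{k. Suc k \<in> - {0, Suc j}} = - {j}" by auto
    then have nths: "nths (e # vs) (- {0, Suc j}) = take j vs @ drop (Suc j) vs"
      using j by (simp add: nths_Cons nths_Compl_singleton)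
    \<comment> \<open>Moving the bracket from the front back to position \<open>j\<close> costs
      \<open>(- 1) ^ j\<close>; with the sign of the pair \<open>(0, Suc j)\<close> a single minus
      remains.\<close>
    have "c (gl_bracket A e (vs ! j) # take j vs @ drop (Suc j) vs)
        = (- 1) ^ j * c (vs[j := gl_bracket A e (vs ! j)])"
      using j cochain_move[OF c carrier_add, of "[]" _ "take j vs"]
      by (simp add: upd_conv_take_nth_drop)
    then show "F (0, Suc j) = - c (vs[j := gl_bracket A e (vs ! j)])"
      by (simp add: F_def nths flip: power_add mult.assoc)
  qed simp
  also have "sum F (map_prod Suc Suc ` I) = (\<Sum>q\<in>I. F (map_prod Suc Suc q))"
    by (subst sum.reindex) (auto simp: inj_on_def)
  also have "\<dots> = (\<Sum>(i, j)\<in>I. - ((- 1) ^ (i + j) * c (e # gl_bracket A (vs ! i) (vs ! j) # nths vs (- {i, j}))))"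
  proof (rule sum.cong)
    fix q assume "q \<in> I"
    obtain i j where q: "q = (i, j)" by force
    have "{k. Suc k \<in> - {Suc i, Suc j}} = - {i, j}" by auto
    then have "nths (e # vs) (- {Suc i, Suc j}) = e # nths vs (- {i, j})"
      by (simp add: nths_Cons)
    \<comment> \<open>Raising both indices by one keeps the parity; the minus comes from exchanging
      \<open>e\<close> with the bracket in front of it.\<close>
    then show "F (map_prod Suc Suc q)
        = (case q of (i, j) \<Rightarrow> - ((- 1) ^ (i + j) * c (e # gl_bracket A (vs ! i) (vs ! j) # nths vs (- {i, j}))))"
      using cochain_swap[OF c carrier_add, of "[]" e] by (simp add: F_def q)
  qed simp
  also have "\<dots> = - ce_diff A (\<lambda>us. c (e # us)) vs"
    using vs by (simp add: ce_diff_def I_def n_def case_prod_unfold sum_negf)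
  finally show ?thesis by (simp add: n_def sum_negf)
qed

lemma ce_diff_mult: "ce_diff A (\<lambda>us. a * c us) vs = a * ce_diff A c vs"
  by (simp add: ce_diff_def sum_distrib_left case_prod_unfold algebra_simps)

text \<open>A cocycle makes the left side of \<open>cartan_formula\<close> vanish, so
  \<open>g\<close> times the cocycle is minus the differential of its contraction; dividing by
  \<open>g\<close> yields the primitive \<open>b\<close>.\<close>

theorem cohomology_trivial_of_inner:
  assumes "(of_int g :: 'a) \<noteq> 0"
  shows "cohomology A k g = {coboundaries A k g}"
proof (rule cohomology_trivial, rule subsetI)
  fix c assume "c \<in> cocycles A k g"
  then have c: "c \<in> graded_cochains A k g" and d: "ce_diff A c = 0" by (auto simp: cocycles_def)
  have cc: "c \<in> cochains A k" using c by (simp add: graded_cochains_def)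
  define b where "b = (\<lambda>us. - inverse (of_int g) * c (e # us))"
  have eq: "c vs = ce_diff A b vs" for vs
  proof (cases "set vs \<subseteq> gl_carrier A")
    case True
    \<comment> \<open>On lists of the wrong length both sides are \<open>0\<close>, so the identity
      holds for all lists over the carrier.\<close>
    have "(\<Sum>j<length vs. c (vs[j := gl_bracket A e (vs ! j)])) = of_int g * c vs"
    proof (cases "length vs = k")
      case True
      then show ?thesis using lie_derivative_eq[OF c True \<open>set vs \<subseteq> gl_carrier A\<close>] by simp
    qed (simp add: cochain_ext[OF cc])
    then have "of_int g * c vs = - ce_diff A (\<lambda>us. c (e # us)) vs"
      using cartan_formula[OF cc True] unfolding d zero_fun_def by (metis diff_0_right eq_iff_diff_eq_0 minus_equation_iff)
    then show ?thesis
      using assms unfolding b_def ce_diff_mult by (simp add: field_simps)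
  next
    case False
    then show ?thesis by (simp add: ce_diff_def cochain_ext[OF cc])
  qed
  show "c \<in> coboundaries A k g"
  proof (cases k)
    case 0
    \<comment> \<open>A 0-cochain vanishes on nonempty lists, so its contraction is
      \<open>0\<close>. Then \<open>c = ce_diff A 0 = 0\<close>, the only coboundary in degree
      0.\<close>
    have "b = 0" by (rule ext) (simp add: b_def cochain_ext[OF cc] 0)
    then have "c = 0" using eq by (auto simp: ce_diff_zero)
    then show ?thesis by (simp add: coboundaries_zero)
  next
    case (Suc l)
    have "b \<in> graded_cochains A l g"
      unfolding b_def using c Suc by (intro contraction_graded_cochain) simp
    moreover have "c = ce_diff A b" using eq by blast
    ultimately show ?thesis by (simp add: coboundaries_def Suc)
  qed
qed

end


section \<open>The Euler element\<close>

lemma lookup_dp_monom: "Poly_Mapping.lookup (dp_monom r) t = (if r = t then 1 else 0)"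
  by (simp add: dp_monom_def lookup_single Poly_Mapping.when_def)

text \<open>In divided powers differentiation is a pure shift of exponents. Exponent subtraction is
  truncated; it is exact on the exponents kept in the sum, whose \<open>i\<close>-th entry is
  positive.\<close>

lemma lookup_dp_deriv:
  "Poly_Mapping.lookup (dp_deriv i f) t = Poly_Mapping.lookup f (t + Poly_Mapping.single i 1)"
proof -
  let ?s = "Poly_Mapping.single i (1::nat)"
  have "r - ?s = t \<longleftrightarrow> r = t + ?s" if "0 < Poly_Mapping.lookup r i" for r
  proof
    assume "r - ?s = t"
    then have "t + ?s = r - ?s + ?s" by simp
    also have "\<dots> = r"
      using that by (intro poly_mapping_eqI) (auto simp: lookup_add lookup_minus lookup_single Poly_Mapping.when_def)
    finally show "r = t + ?s" by simp
  qed simp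
  then have "Poly_Mapping.lookup (dp_deriv i f) t
      = (\<Sum>r\<in>{r \<in> Poly_Mapping.keys f. 0 < Poly_Mapping.lookup r i}. if r = t + ?s then Poly_Mapping.lookup f r else 0)"
    unfolding dp_deriv_def lookup_sum by (intro sum.cong) (auto simp: lookup_dp_monom)
  also have "\<dots> = Poly_Mapping.lookup f (t + ?s)"
    by (auto simp: in_keys_iff lookup_add lookup_single)
  finally show ?thesis .
qed

text \<open>Away from \<open>j\<close> every factor is a binomial coefficient over \<open>0\<close>,
  hence 1.\<close>

lemma mbinomial_add_single:
  "mbinomial (s + Poly_Mapping.single j 1) (Poly_Mapping.single j 1) = Suc (Poly_Mapping.lookup s j)"
proof -
  let ?t = "s + Poly_Mapping.single j 1"
  have j: "j \<in> Poly_Mapping.keys ?t" by (simp add: in_keys_iff lookup_add lookup_single)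
  have "mbinomial ?t (Poly_Mapping.single j 1)
      = (\<Prod>i\<in>Poly_Mapping.keys ?t. if i = j then Suc (Poly_Mapping.lookup s j) else 1)"
    unfolding mbinomial_def by (rule prod.cong) (auto simp: lookup_add lookup_single Poly_Mapping.when_def)
  also have "\<dots> = Suc (Poly_Mapping.lookup s j)"
    using j by (simp add: prod.delta)
  finally show ?thesis .
qed

text \<open>The binomial factor in the divided power product turns \<open>x_j d_j\<close> into the
  operator that multiplies each monomial by its \<open>j\<close>-th exponent.\<close>

lemma lookup_mult_var_deriv:
  fixes f :: "'a::field dp"
  shows "Poly_Mapping.lookup (dp_mult (dp_monom (Poly_Mapping.single j 1)) (dp_deriv j f)) t
    = of_nat (Poly_Mapping.lookup t j) * Poly_Mapping.lookup f t"
proof -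
  let ?s = "Poly_Mapping.single j (1::nat)" and ?h = "dp_deriv j f"
  have keys: "Poly_Mapping.keys (dp_monom ?s :: 'a dp) = {?s}"
    by (simp add: dp_monom_def)
  have "Poly_Mapping.lookup (dp_mult (dp_monom ?s) ?h) t
      = (\<Sum>s\<in>Poly_Mapping.keys ?h. if ?s + s = t then of_nat (Poly_Mapping.lookup t j) * Poly_Mapping.lookup f t else 0)"
    unfolding dp_mult_def keys
    by (auto simp: lookup_sum lookup_dp_monom mbinomial_add_single[simplified] lookup_dp_deriv
        lookup_add lookup_single add.commute intro!: sum.cong)
  also have "\<dots> = of_nat (Poly_Mapping.lookup t j) * Poly_Mapping.lookup f t"
  \<comment> \<open>If the value is \<open>0\<close>, so is every summand. Otherwise the
    \<open>j\<close>-th exponent of \<open>t\<close> is positive, subtraction is exact, and only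
    \<open>s = t - ?s\<close> contributes.\<close>
  proof (cases "of_nat (Poly_Mapping.lookup t j) * Poly_Mapping.lookup f t = 0")
    case True
    show ?thesis unfolding True by simp
  next
    case False
    then have "Poly_Mapping.lookup t j \<noteq> 0" by (metis mult_zero_left of_nat_0)
    then have t: "?s + (t - ?s) = t"
      by (intro poly_mapping_eqI) (auto simp: lookup_add lookup_minus lookup_single Poly_Mapping.when_def)
    then have iff: "?s + s = t \<longleftrightarrow> s = t - ?s" for s by (metis add_left_cancel)
    have "t - ?s \<in> Poly_Mapping.keys ?h"
      using False t by (simp add: in_keys_iff lookup_dp_deriv add.commute)
    then show ?thesis unfolding iff by simp
  qed
  finally show ?thesis .
qed

section \<open>The Euler element and its adjoint action\<close>

definition euler_exp :: "nat \<Rightarrow> nat \<Rightarrow> mindex" where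
  "euler_exp m i = Poly_Mapping.single i 1 + Poly_Mapping.single (i + m) 1"

definition euler :: "nat \<Rightarrow> 'a::field dp" where
  "euler m = (\<Sum>i=1..m. dp_monom (euler_exp m i))"

lemma lookup_euler_exp:
  "Poly_Mapping.lookup (euler_exp m i) j = (if j = i then 1 else 0) + (if j = i + m then 1 else 0)"
  by (auto simp: euler_exp_def lookup_add lookup_single Poly_Mapping.when_def)

text \<open>Since \<open>i\<close> lies in \<open>{1..m}\<close>, the indeterminates numbered
  \<open>i\<close> and \<open>i + m\<close> occur only in the \<open>i\<close>-th summand;
  differentiating by one leaves the other.\<close>

lemma dp_deriv_euler:
  assumes i: "i \<in> {1..m}"
  shows "dp_deriv i (euler m :: 'a::field dp) = dp_monom (Poly_Mapping.single (i + m) 1)"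
    and "dp_deriv (i + m) (euler m :: 'a dp) = dp_monom (Poly_Mapping.single i 1)"
proof -
  have l: "Poly_Mapping.lookup (euler m :: 'a dp) (t + Poly_Mapping.single q 1) = Poly_Mapping.lookup (dp_monom u) t"
    if "q \<in> {i, i + m}" "euler_exp m i = u + Poly_Mapping.single q 1" for t u q
  proof -
    have "k = i" if "euler_exp m k = t + Poly_Mapping.single q 1" "k \<in> {1..m}" for k
    proof -
      have "Poly_Mapping.lookup (euler_exp m k) q \<noteq> 0"
        unfolding that(1) by (simp add: lookup_add lookup_single)
      then show ?thesis
        using that(2) i \<open>q \<in> {i, i + m}\<close> by (auto simp: lookup_euler_exp split: if_splits)
    qed
    then have "euler_exp m k = t + Poly_Mapping.single q 1 \<longleftrightarrow> k = i \<and> u = t" if "k \<in> {1..m}" for k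
      using that \<open>euler_exp m i = _\<close> by (metis add_right_cancel)
    then have "Poly_Mapping.lookup (euler m :: 'a dp) (t + Poly_Mapping.single q 1)
        = (\<Sum>k=1..m. if k = i then Poly_Mapping.lookup (dp_monom u) t else 0)"
      unfolding euler_def lookup_sum by (intro sum.cong) (auto simp: lookup_dp_monom)
    then show ?thesis using i by simp
  qed
  show "dp_deriv i (euler m :: 'a dp) = dp_monom (Poly_Mapping.single (i + m) 1)"
    by (rule poly_mapping_eqI, unfold lookup_dp_deriv, rule l) (simp_all add: euler_exp_def add.commute)
  show "dp_deriv (i + m) (euler m :: 'a dp) = dp_monom (Poly_Mapping.single i 1)"
    by (rule poly_mapping_eqI, unfold lookup_dp_deriv, rule l) (simp_all add: euler_exp_def)
qed

text \<open>By \<open>dp_deriv_euler\<close> the bracket is the sum of the operators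
  \<open>x_(i+m) d_(i+m) - x_i d_i\<close>, whose eigenvalues add up to the grade.\<close>

lemma lookup_poisson_euler:
  "Poly_Mapping.lookup (poisson m (euler m) f) t = of_int (sym_grade m t) * Poly_Mapping.lookup f t"
proof -
  have "Poly_Mapping.lookup (poisson m (euler m) f) t
      = (\<Sum>i=1..m. of_int (int (Poly_Mapping.lookup t (i + m)) - int (Poly_Mapping.lookup t i)) * Poly_Mapping.lookup f t)"
    unfolding poisson_def lookup_sum
  proof (rule sum.cong[OF refl])
    fix i assume i: "i \<in> {1..m}"
    show "Poly_Mapping.lookup (dp_mult (dp_deriv i (euler m)) (dp_deriv (i + m) f)
          - dp_mult (dp_deriv (i + m) (euler m)) (dp_deriv i f)) t
        = of_int (int (Poly_Mapping.lookup t (i + m)) - int (Poly_Mapping.lookup t i)) * Poly_Mapping.lookup f t"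
      unfolding dp_deriv_euler[OF i] lookup_minus lookup_mult_var_deriv by (simp add: algebra_simps)
  qed
  then show ?thesis by (simp add: sym_grade_def sum_distrib_right)
qed

text \<open>The exponent \<open>0\<close> has grade \<open>0\<close>, so a bracket with the Euler
  element has no constant term, and the Hamiltonian and Poisson brackets agree on it.\<close>

lemma drop_const_poisson_euler: "drop_const (poisson m (euler m) f) = poisson m (euler m) f"
  by (rule poly_mapping_eqI) (simp add: drop_const_def lookup_minus lookup_poisson_euler sym_grade_def)

text \<open>Stated for any bracket that agrees with the Poisson bracket on the Euler element, so
  that one argument serves the Poisson algebras and their quotients.\<close>

lemma inner_graded_span_alg:
  fixes bracket :: "'a::field dp \<Rightarrow> 'a dp \<Rightarrow> 'a dp"
  assumes br: "\<And>f. bracket (euler m) f = poisson m (euler m) f"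
    and S: "\<And>i. i \<in> {1..m} \<Longrightarrow> euler_exp m i \<in> S"
  shows "inner_graded_lie (span_alg m S bracket) (euler m) (dp_monom ` S)"
proof -
  have grade: "sym_grade m (euler_exp m i) = 0" if "i \<in> {1..m}" for i
    using that unfolding sym_grade_def by (intro sum.neutral) (auto simp: lookup_euler_exp)
  have lookup: "Poly_Mapping.lookup (bracket (euler m) f) t = of_int (sym_grade m t) * Poly_Mapping.lookup f t" for f t
    by (simp add: br lookup_poisson_euler)
  have "vector_space (dp_scale :: 'a \<Rightarrow> _)" by unfold_locales
  moreover have "bracket (euler m) (x + y) = bracket (euler m) x + bracket (euler m) y" for x y
    by (rule poly_mapping_eqI) (simp add: lookup lookup_add algebra_simps)
  moreover have "bracket (euler m) (dp_scale a x) = dp_scale a (bracket (euler m) x)" for a x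
    by (rule poly_mapping_eqI) (simp add: lookup algebra_simps)
  moreover have "\<exists>h. b \<in> dp.span (dp_monom ` {r \<in> S. sym_grade m r = h}) \<and> bracket (euler m) b = dp_scale (of_int h) b"
    if b: "b \<in> dp_monom ` S" for b
  proof -
    from b obtain r where r: "r \<in> S" "b = dp_monom r" by blast
    then have "bracket (euler m) b = dp_scale (of_int (sym_grade m r)) b"
      by (intro poly_mapping_eqI) (simp add: lookup lookup_dp_monom)
    moreover have "b \<in> dp.span (dp_monom ` {s \<in> S. sym_grade m s = sym_grade m r})"
      using r by (intro dp.span_base) simp
    ultimately show ?thesis by blast
  qed
  moreover have "euler m \<in> dp.span (dp_monom ` S)"
    unfolding euler_def using S by (intro dp.span_sum dp.span_base imageI)
  moreover have "euler m \<in> dp.span (dp_monom ` {r \<in> S. sym_grade m r = 0})"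
    unfolding euler_def using S grade by (intro dp.span_sum dp.span_base imageI) blast
  ultimately show ?thesis
    by (simp add: inner_graded_lie_def inner_graded_lie_axioms_def span_alg_def)
qed

section \<open>Membership of the Euler element and the conclusion\<close>

lemma euler_exp_trunc:
  assumes "2 \<le> p" "i \<in> {1..m}"
  shows "euler_exp m i \<in> trunc_exps m p - {0}" "total_degree (euler_exp m i) = 2"
proof -
  have k: "Poly_Mapping.keys (euler_exp m i) = {i, i + m}"
    by (auto simp: in_keys_iff lookup_euler_exp split: if_splits)
  then show "euler_exp m i \<in> trunc_exps m p - {0}"
    using assms by (auto simp: trunc_exps_def lookup_euler_exp)
  show "total_degree (euler_exp m i) = 2"
    unfolding total_degree_def k using assms by (auto simp: lookup_euler_exp)
qed

theorem proposition3:
  fixes m p k :: nat and g :: int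
    and A :: "('a::field, 'a dp) graded_lie"
  assumes "CHAR('a) = p" and "p > 0" and "m \<ge> 1"
    and "A \<in> {ham_alg m p, ham2_alg m p, po_alg m p, po2_alg m p}"
    and "m = 1 \<and> p = 2 \<Longrightarrow> A \<notin> {ham2_alg m p, po2_alg m p}"
    and "cohomology A k g \<noteq> {coboundaries A k g}"
  shows "int p dvd g"
proof (rule ccontr)
  assume "\<not> int p dvd g"
  then have g: "(of_int g :: 'a) \<noteq> 0"
    using assms(1) by (simp add: of_int_eq_0_iff_char_dvd)
  have "p \<noteq> 1" using assms(1) CHAR_not_1[where 'a = 'a] by simp
  then have p: "2 \<le> p" using assms(2) by linarith
  have po: "euler_exp m i \<in> po_exps m p - {0}" if "i \<in> {1..m}" for i
    using euler_exp_trunc(1)[OF p that] by (auto simp: po_exps_def)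
  have po2: "euler_exp m i \<in> po2_exps m p - {0}" if "i \<in> {1..m}" "\<not> (m = 1 \<and> p = 2)" for i
  proof -
    \<comment> \<open>The Euler monomials have degree 2, which must stay strictly below the top
      degree. The product \<open>m * (p - 1)\<close> is 1 only for \<open>m = 1\<close> and
      \<open>p = 2\<close>; otherwise the top degree is at least 4.\<close>
    have "2 < 2 * m * (p - 1)"
    proof (cases "m = 1")
      case True
      then show ?thesis using that p by auto
    next
      case False
      have "2 * 1 \<le> m * (p - 1)" using False assms(3) p by (intro mult_le_mono) auto
      then show ?thesis by simp
    qed
    then show ?thesis using euler_exp_trunc[OF p that(1)] by (auto simp: po2_exps_def)
  qed
  \<comment> \<open>All remaining cases are brought to one common form, to which the inner grading
    argument applies.\<close>
  have "\<exists>S bracket. A = span_alg m S bracket \<and> (\<forall>i\<in>{1..m}. euler_exp m i \<in> S) \<and>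
      (\<forall>f. bracket (euler m) f = poisson m (euler m) f)"
    using assms(4,5) po po2 drop_const_poisson_euler
    unfolding ham_alg_def ham2_alg_def po_alg_def po2_alg_def by blast
  then obtain S bracket where "A = span_alg m S bracket" "\<And>i. i \<in> {1..m} \<Longrightarrow> euler_exp m i \<in> S"
    "\<And>f. bracket (euler m) f = poisson m (euler m) f"
    by blast
  then have "inner_graded_lie A (euler m) (dp_monom ` S)"
    using inner_graded_span_alg by blast
  then have "cohomology A k g = {coboundaries A k g}"
    using inner_graded_lie.cohomology_trivial_of_inner g by blast
  with assms(6) show False ..
qed

end
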